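(* Let $k\ge 2$, $M\ge 3$, $d,N\ge 1$, let $X\in\mathbb{R}^{d\times M}$ have pairwise distinct columns, let $\sigma:\mathbb{R}\to\mathbb{R}$ be a non-linear activation function, and let $Z\in\mathbb{R}^{k\times M}$ be a matrix whose $M$ columns are points of $\mathbb{R}^k$ in general position, meaning that no three of them are collinear. Then there exist no parameters $u_1\in\mathbb{R}^{N\times 1}$, $v_1\in\mathbb{R}^{d\times 1}$, $b_1\in\mathbb{R}^N$, $u_2\in\mathbb{R}^{k\times 1}$, $v_2\in\mathbb{R}^{N\times 1}$, $b_2\in\mathbb{R}^k$ satisfying $$u_2v_2^T\,\sigma\big(u_1v_1^TX+b_1\mathbf{1}_M^T\big)+b_2\mathbf{1}_M^T=Z .$$
   Context: $\mathbf{1}_M\in\mathbb{R}^M$ is the column vector of ones, and $\sigma$ is applied entrywise to matrices. *)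

theory Defs
  imports "HOL-Analysis.Analysis"
begin

(* The outer product of b with the all-ones row vector; "1 :: real^'m" is the vector all of whose
   entries are 1. *)
definition bias_matrix :: "real^'r \<Rightarrow> real^'m^'r" where
  "bias_matrix b = (columnvector b :: real^1^'r) ** (rowvector (1 :: real^'m) :: real^'m^1)"

(* Quantifying over indices rather than over points makes repeated columns a violation of general
   position as soon as there are at least three columns. *)
definition columns_in_general_position :: "real^'m^'k \<Rightarrow> bool" where
  "columns_in_general_position Z \<longleftrightarrow>
     (\<forall>i j l. i \<noteq> j \<longrightarrow> i \<noteq> l \<longrightarrow> j \<noteq> l \<longrightarrow> \<not> collinear {column i Z, column j Z, column l Z})"

end

theory Submission
  imports Defs
begin

text \<open>The row \<open>transpose v2\<close> collapses the hidden layer to one scalar per data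
  point, so every output column is \<open>b2\<close> plus a scalar multiple of the single column of
  \<open>u2\<close>. All outputs thus lie on one line (or coincide), by
  \<open>collinear_columns_affine_rank_one\<close>, whereas three columns of \<open>Z\<close> are
  not collinear.\<close>

lemma collinear_columns_affine_rank_one:
  fixes u :: "real^1^'k" and A :: "real^'m^1" and b :: "real^'k"
  shows "collinear (range (\<lambda>j. column j (u ** A + bias_matrix b)))"
proof -
  \<comment> \<open>The bias cancels in differences, leaving \<open>column 1 u\<close> as the common
    direction that \<open>collinear_def\<close> asks for; it may be zero.\<close>
  have "column i (u ** A + bias_matrix b) - column j (u ** A + bias_matrix b)
      = (A $ 1 $ i - A $ 1 $ j) *\<^sub>R column 1 u" for i j
    by (simp add: vec_eq_iff column_def matrix_matrix_mult_def bias_matrix_def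
        columnvector_def rowvector_def algebra_simps)
  then show ?thesis
    unfolding collinear_def by blast
qed

theorem theorem2:
  fixes X :: "real^'m^'d" and Z :: "real^'m^'k" and \<sigma> :: "real \<Rightarrow> real"
  assumes "CARD('k) \<ge> 2" and "CARD('m) \<ge> 3"
    and "inj (\<lambda>j. column j X)"
    and "\<not> linear \<sigma>"
    and "columns_in_general_position Z"
  shows "\<not> (\<exists>(u1 :: real^1^'n) (v1 :: real^1^'d) (b1 :: real^'n)
              (u2 :: real^1^'k) (v2 :: real^1^'n) (b2 :: real^'k).
            u2 ** transpose v2 ** map_matrix \<sigma> (u1 ** transpose v1 ** X + bias_matrix b1)
              + bias_matrix b2 = Z)"
proof -
  obtain I :: "'m set" where "card I = 3"
    using \<open>CARD('m) \<ge> 3\<close> by (rule obtain_subset_with_card_n)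
  then obtain i j l :: 'm where "i \<noteq> j" "i \<noteq> l" "j \<noteq> l"
    by (auto simp: card_3_iff)
  then have "\<not> collinear {column i Z, column j Z, column l Z}"
    using \<open>columns_in_general_position Z\<close> by (simp add: columns_in_general_position_def)
  then have "\<not> collinear (range (\<lambda>j. column j Z))"
    by (rule contrapos_nn) (erule collinear_subset, blast)
  then show ?thesis
    \<comment> \<open>Reassociating to the right exposes the factor after \<open>u2\<close> as a
      one-row matrix, the \<open>A\<close> of the lemma.\<close>
    using collinear_columns_affine_rank_one by (auto simp flip: matrix_mul_assoc)
qed

end
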